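(* Let $X$ be a real Banach space, let $\mathcal{U}$ be a free ultrafilter on $\mathbb{N}$, and let $\jmath\colon X\to X^{\mathcal{U}}$ be the canonical inclusion of $X$ into its ultrapower. A point $x\in S_X$ is a LUR point of $X$ if and only if $\jmath(x)$ is not contained in any non-degenerate line segment contained in $S_{X^{\mathcal{U}}}$.
   Context: $S_X$ denotes the unit sphere of $X$. The ultrapower is $X^{\mathcal{U}}=\ell^\infty(X)/N_{\mathcal{U}}$ with the quotient norm, where $N_{\mathcal{U}}=\{(x_n)\in\ell^\infty(X)\colon \lim_{n,\mathcal{U}}\|x_n\|=0\}$; the coset of $(x_n)$ is written $(x_n)^{\mathcal{U}}$, and $\|(x_n)^{\mathcal{U}}\|=\lim_{n,\mathcal{U}}\|x_n\|$. The canonical inclusion is $\jmath(x)=(x,x,x,\ldots)^{\mathcal{U}}$. A point $x\in S_X$ is a LUR (locally uniformly rotund) point if for every sequence $(x_n)\subset S_X$ with $\|x+x_n\|\to 2$ one has $\|x-x_n\|\to 0$. A non-degenerate line segment is a set $\{(1-t)u+tv\colon t\in[0,1]\}$ with $u\neq v$. *)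

theory Defs
  imports "HOL-Analysis.Analysis"
begin

section \<open>Free ultrafilters\<close>

text \<open>A filter of type \<^typ>\<open>nat filter\<close> may be improper, hence the condition \<open>U \<noteq> bot\<close>. An
  ultrafilter is free if no singleton (equivalently, no finite set) belongs to it.\<close>

definition free_ultrafilter :: "nat filter \<Rightarrow> bool" where
  "free_ultrafilter U \<longleftrightarrow>
     U \<noteq> bot \<and>
     (\<forall>P. eventually P U \<or> eventually (\<lambda>n. \<not> P n) U) \<and>
     (\<forall>m. \<not> eventually (\<lambda>n. n = m) U)"

section \<open>Quotients of normed spaces\<close>

text \<open>The quotient of a normed space by a subspace \<open>N\<close> is represented by its set of cosets
  \<open>f + N\<close>. It is not a type of its own, since here \<open>N\<close> depends on an ultrafilter, which is a
  variable. The operations are defined by choosing representatives in all possible ways.\<close>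

definition coset :: "'b::real_normed_vector set \<Rightarrow> 'b \<Rightarrow> 'b set" where
  "coset N f = {f + h | h. h \<in> N}"

definition quotient_space :: "'b::real_normed_vector set \<Rightarrow> 'b set set" where
  "quotient_space N = range (coset N)"

definition coset_add :: "'b::real_normed_vector set \<Rightarrow> 'b set \<Rightarrow> 'b set \<Rightarrow> 'b set" where
  "coset_add N A B = (\<Union>f\<in>A. \<Union>g\<in>B. coset N (f + g))"

definition coset_scaleR :: "'b::real_normed_vector set \<Rightarrow> real \<Rightarrow> 'b set \<Rightarrow> 'b set" where
  "coset_scaleR N c A = (\<Union>f\<in>A. coset N (c *\<^sub>R f))"

definition quotient_norm :: "'b::real_normed_vector set \<Rightarrow> real" where
  "quotient_norm A = (INF f\<in>A. norm f)"

definition quotient_sphere :: "'b::real_normed_vector set \<Rightarrow> 'b set set" where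
  "quotient_sphere N = {A \<in> quotient_space N. quotient_norm A = 1}"

definition quotient_segment :: "'b::real_normed_vector set \<Rightarrow> 'b set \<Rightarrow> 'b set \<Rightarrow> 'b set set" where
  "quotient_segment N A B =
     {coset_add N (coset_scaleR N (1 - t) A) (coset_scaleR N t B) | t. 0 \<le> t \<and> t \<le> 1}"

lemma coset_eq_iff:
  assumes "subspace N"
  shows "coset N f = coset N g \<longleftrightarrow> f - g \<in> N"
proof
  assume "coset N f = coset N g"
  moreover have "f \<in> coset N f"
    using subspace_0[OF assms] by (force simp: coset_def)
  ultimately show "f - g \<in> N"
    by (auto simp: coset_def)
next
  assume *: "f - g \<in> N"
  have "\<exists>k\<in>N. f + h = g + k" if "h \<in> N" for h
    using subspace_add[OF assms * that] by (intro bexI[of _ "(f - g) + h"]) auto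
  moreover have "\<exists>k\<in>N. g + h = f + k" if "h \<in> N" for h
    using subspace_diff[OF assms that *] by (intro bexI[of _ "h - (f - g)"]) auto
  ultimately show "coset N f = coset N g"
    unfolding coset_def by blast
qed

lemma coset_add_coset:
  assumes "subspace N"
  shows "coset_add N (coset N f) (coset N g) = coset N (f + g)"
proof -
  have "coset N (f' + g') = coset N (f + g)" if "f' \<in> coset N f" "g' \<in> coset N g" for f' g'
  proof -
    obtain h k where "h \<in> N" "k \<in> N" "f' = f + h" "g' = g + k"
      using \<open>f' \<in> coset N f\<close> \<open>g' \<in> coset N g\<close> by (auto simp: coset_def)
    then show ?thesis
      using subspace_add[OF assms] by (simp add: coset_eq_iff[OF assms])
  qed
  moreover have "f \<in> coset N f" "g \<in> coset N g"
    using subspace_0[OF assms] by (force simp: coset_def)+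
  ultimately show ?thesis
    unfolding coset_add_def by blast
qed

lemma coset_scaleR_coset:
  assumes "subspace N"
  shows "coset_scaleR N c (coset N f) = coset N (c *\<^sub>R f)"
proof -
  have "coset N (c *\<^sub>R f') = coset N (c *\<^sub>R f)" if "f' \<in> coset N f" for f'
  proof -
    obtain h where "h \<in> N" "f' = f + h"
      using \<open>f' \<in> coset N f\<close> by (auto simp: coset_def)
    then show ?thesis
      using subspace_scale[OF assms] by (simp add: coset_eq_iff[OF assms] scaleR_add_right)
  qed
  moreover have "f \<in> coset N f"
    using subspace_0[OF assms] by (force simp: coset_def)
  ultimately show ?thesis
    unfolding coset_scaleR_def by blast
qed

section \<open>The ultrapower\<close>

text \<open>As \<^typ>\<open>nat\<close> carries the discrete topology, \<^typ>\<open>nat \<Rightarrow>\<^sub>C 'a\<close> is the space of all bounded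
  sequences in \<^typ>\<open>'a\<close> with the supremum norm.\<close>

definition null_seqs :: "nat filter \<Rightarrow> (nat \<Rightarrow>\<^sub>C 'a::real_normed_vector) set" where
  "null_seqs U = {f. ((\<lambda>n. norm (apply_bcontfun f n)) \<longlongrightarrow> 0) U}"

abbreviation ultrapower :: "nat filter \<Rightarrow> (nat \<Rightarrow>\<^sub>C 'a::real_normed_vector) set set" where
  "ultrapower U \<equiv> quotient_space (null_seqs U)"

definition ultrapower_embed :: "nat filter \<Rightarrow> 'a::real_normed_vector \<Rightarrow> (nat \<Rightarrow>\<^sub>C 'a) set" where
  "ultrapower_embed U x = coset (null_seqs U) (const_bcontfun x)"

lemma subspace_null_seqs: "subspace (null_seqs U)"
  unfolding subspace_def null_seqs_def
  by (auto simp: tendsto_norm_zero_iff intro!: tendsto_add_zero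
      tendsto_scaleR[OF tendsto_const, where b = 0, simplified])

lemma quotient_norm_coset_tendsto:
  fixes f :: "nat \<Rightarrow>\<^sub>C 'a::real_normed_vector"
  assumes "free_ultrafilter U"
  shows "((\<lambda>n. norm (apply_bcontfun f n)) \<longlongrightarrow> quotient_norm (coset (null_seqs U) f)) U"
    (is "(_ \<longlongrightarrow> ?q) U")
proof (rule tendstoI)
  fix e :: real
  assume e: "e > 0"
  let ?C = "coset (null_seqs U) f"
  have bdd: "bdd_below (norm ` ?C)"
    by (rule bdd_belowI[of _ 0]) auto
  have "f \<in> ?C"
    using subspace_0[OF subspace_null_seqs] by (force simp: coset_def)
  then obtain g where g: "g \<in> ?C" "norm g < ?q + e / 2"
    using cInf_lessD[of "norm ` ?C" "?q + e / 2"] e by (auto simp: quotient_norm_def)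
  then obtain h where h: "h \<in> null_seqs U" "g = f + h"
    by (auto simp: coset_def)
  have "eventually (\<lambda>n. norm (apply_bcontfun h n) < e / 2) U"
    using h(1) e order_tendstoD(2)[of "\<lambda>n. norm (apply_bcontfun h n)" 0 U "e / 2"]
    by (simp add: null_seqs_def)
  then have upper: "eventually (\<lambda>n. norm (apply_bcontfun f n) < ?q + e) U"
  proof eventually_elim
    case (elim n)
    have "apply_bcontfun f n = apply_bcontfun g n - apply_bcontfun h n"
      using h(2) by simp
    moreover have "norm (apply_bcontfun g n) \<le> norm g"
      by (rule norm_bounded)
    ultimately show ?case
      using elim g(2) norm_triangle_ineq4[of "apply_bcontfun g n" "apply_bcontfun h n"] by simp
  qed
  have lower: "eventually (\<lambda>n. norm (apply_bcontfun f n) > ?q - e) U"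
  proof (rule ccontr)
    assume "\<not> ?thesis"
    then have ev: "eventually (\<lambda>n. norm (apply_bcontfun f n) \<le> ?q - e) U"
      using assms unfolding free_ultrafilter_def not_less[symmetric] by blast
    have "U \<noteq> bot"
      using assms by (simp add: free_ultrafilter_def)
    then obtain m where "norm (apply_bcontfun f m) \<le> ?q - e"
      using eventually_happens[OF ev] by auto
    then have q: "0 \<le> ?q - e"
      by (rule order_trans[OF norm_ge_zero])
    define k where
      "k = (\<lambda>n. if norm (apply_bcontfun f n) \<le> ?q - e then apply_bcontfun f n else 0)"
    have "k \<in> bcontfun"
      by (rule bcontfun_normI[of _ "?q - e"]) (use q in \<open>auto simp: k_def\<close>)
    then have k: "apply_bcontfun (Bcontfun k) = k"
      by (rule Bcontfun_inverse)
    have "norm (Bcontfun k) \<le> ?q - e"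
      by (rule norm_bound, unfold k) (use q in \<open>simp add: k_def\<close>)
    moreover have "Bcontfun k - f \<in> null_seqs U"
      unfolding null_seqs_def mem_Collect_eq
      by (rule tendsto_eventually, rule eventually_mono[OF ev]) (simp add: k, simp add: k_def)
    then have "Bcontfun k \<in> ?C"
      by (force simp: coset_def)
    then have "?q \<le> norm (Bcontfun k)"
      unfolding quotient_norm_def by (intro cINF_lower bdd)
    ultimately show False
      using e by simp
  qed
  show "eventually (\<lambda>n. dist (norm (apply_bcontfun f n)) ?q < e) U"
    using upper lower by eventually_elim (simp add: dist_real_def abs_less_iff)
qed

section \<open>LUR points\<close>

definition LUR_point :: "'a::real_normed_vector \<Rightarrow> bool" where
  "LUR_point x \<longleftrightarrow>
     x \<in> sphere 0 1 \<and>
     (\<forall>s. (\<forall>n::nat. s n \<in> sphere 0 1) \<longrightarrow>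
          (\<lambda>n. norm (x + s n)) \<longlonglongrightarrow> 2 \<longrightarrow> (\<lambda>n. norm (x - s n)) \<longlonglongrightarrow> 0)"

end

theory Submission
  imports Defs
begin

text \<open>A LUR point \<open>x\<close> is one for which \<open>norm (x + y)\<close> close to \<open>2\<close> forces the unit vector \<open>y\<close> to
  be close to \<open>x\<close>; in this form the notion passes from sequences to arbitrary filters. If the
  image of \<open>x\<close> lies on a segment in the unit sphere of the ultrapower, then so do its midpoints
  with the two endpoints, so by rotundity along the ultrafilter both endpoints equal the image.
  Conversely, unit vectors \<open>y n\<close> that stay away from \<open>x\<close> although \<open>norm (x + y n)\<close> tends to \<open>2\<close>
  give a second point of the ultrapower, and the segment from the image of \<open>x\<close> to it stays in the
  sphere because \<open>norm ((1 - t) *\<^sub>R x + t *\<^sub>R y) \<ge> norm (x + y) - 1\<close>.\<close>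

text \<open>The gap \<open>e\<close> is kept at every index, so it persists along an ultrafilter
  too: the sequence both refutes the LUR property and supplies a second point of the
  ultrapower.\<close>

lemma not_uniformly_rotund_at_sequence:
  fixes x :: "'a::real_normed_vector"
  assumes "norm x = 1"
    and "\<not> (\<forall>e>0. \<exists>d>0. \<forall>y. norm y = 1 \<longrightarrow> norm (x + y) > 2 - d \<longrightarrow> norm (x - y) < e)"
  obtains e s where "e > 0" "\<And>n::nat. norm (s n) = 1" "(\<lambda>n. norm (x + s n)) \<longlonglongrightarrow> 2"
    "\<And>n. \<not> norm (x - s n) < e"
proof -
  obtain e where e: "e > 0"
    and ex: "\<And>d. d > 0 \<Longrightarrow> \<exists>y. norm y = 1 \<and> norm (x + y) > 2 - d \<and> \<not> norm (x - y) < e"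
    using assms(2) by blast
  \<comment> \<open>Choosing \<open>d = 1 / Suc n\<close>, positive also at \<open>n = 0\<close>,
    squeezes the norms between quantities tending to 2.\<close>
  have "\<exists>y. norm y = 1 \<and> norm (x + y) > 2 - 1 / real (Suc n) \<and> \<not> norm (x - y) < e" for n
    by (rule ex) simp
  then obtain s where s: "\<And>n. norm (s n) = 1"
      "\<And>n. norm (x + s n) > 2 - 1 / real (Suc n)" "\<And>n. \<not> norm (x - s n) < e"
    by metis
  have "(\<lambda>n. norm (x + s n)) \<longlonglongrightarrow> 2"
  proof (rule tendsto_sandwich)
    show "(\<lambda>n. 2 - 1 / real (Suc n)) \<longlonglongrightarrow> 2"
      using tendsto_diff[OF tendsto_const LIMSEQ_inverse_real_of_nat, of 2]
      by (simp add: inverse_eq_divide)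
    show "\<forall>\<^sub>F n in sequentially. 2 - 1 / real (Suc n) \<le> norm (x + s n)"
      using s(2) by (intro always_eventually allI less_imp_le)
    show "\<forall>\<^sub>F n in sequentially. norm (x + s n) \<le> 2"
      using norm_triangle_ineq[of x] s(1) assms(1)
      by (intro always_eventually allI) (metis one_add_one)
  qed auto
  with e s that show thesis
    by blast
qed

text \<open>The definition speaks only of limits along \<open>sequentially\<close>; an epsilon-delta
  condition can be evaluated along any filter.\<close>

lemma LUR_point_iff_uniform:
  "LUR_point x \<longleftrightarrow> norm x = 1 \<and>
     (\<forall>e>0. \<exists>d>0. \<forall>y. norm y = 1 \<longrightarrow> norm (x + y) > 2 - d \<longrightarrow> norm (x - y) < e)"
  (is "_ \<longleftrightarrow> _ \<and> ?U")
proof (intro iffI conjI)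
  assume L: "LUR_point x"
  then show "norm x = 1"
    by (simp add: LUR_point_def)
  show ?U
  proof (rule ccontr)
    assume "\<not> ?U"
    then obtain e s where e: "e > 0" and s: "\<And>n::nat. norm (s n) = 1"
        "(\<lambda>n. norm (x + s n)) \<longlonglongrightarrow> 2" "\<And>n. \<not> norm (x - s n) < e"
      using not_uniformly_rotund_at_sequence[OF \<open>norm x = 1\<close>] by blast
    then have "(\<lambda>n. norm (x - s n)) \<longlonglongrightarrow> 0"
      using L s(1,2) by (simp add: LUR_point_def)
    from order_tendstoD(2)[OF this e] s(3) show False
      by simp
  qed
next
  assume R: "norm x = 1 \<and> ?U"
  have "(\<lambda>n. norm (x - s n)) \<longlonglongrightarrow> 0"
    if s: "\<forall>n::nat. s n \<in> sphere 0 1" and lim: "(\<lambda>n. norm (x + s n)) \<longlonglongrightarrow> 2" for s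
  proof (rule tendstoI)
    fix e :: real
    assume "e > 0"
    then obtain d where d: "d > 0"
        "\<And>y. norm y = 1 \<Longrightarrow> norm (x + y) > 2 - d \<Longrightarrow> norm (x - y) < e"
      using R by blast
    have "\<forall>\<^sub>F n in sequentially. norm (x + s n) > 2 - d"
      using order_tendstoD(1)[OF lim, of "2 - d"] d(1) by simp
    then show "\<forall>\<^sub>F n in sequentially. dist (norm (x - s n)) 0 < e"
      by eventually_elim (use s d(2) in simp)
  qed
  with R show "LUR_point x"
    by (simp add: LUR_point_def)
qed

text \<open>Representatives of points of the ultrapower's sphere have norms that merely tend to 1.
  Normalising them by \<open>sgn\<close> costs a null error, after which the uniform condition
  applies.\<close>

lemma LUR_point_tendsto:
  fixes g :: "'b \<Rightarrow> 'a::real_normed_vector"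
  assumes L: "LUR_point x" and g: "((\<lambda>n. norm (g n)) \<longlongrightarrow> 1) F"
    and xg: "((\<lambda>n. norm (x + g n)) \<longlongrightarrow> 2) F"
  shows "((\<lambda>n. norm (x - g n)) \<longlongrightarrow> 0) F"
proof -
  \<comment> \<open>Equality holds for nonzero \<open>g n\<close>; otherwise
    \<open>sgn (g n) = 0\<close> and the left side vanishes.\<close>
  have diff: "norm (g n - sgn (g n)) \<le> \<bar>norm (g n) - 1\<bar>" for n
  proof (cases "g n = 0")
    case False
    then have "norm (g n) *\<^sub>R sgn (g n) = g n"
      by (simp add: sgn_div_norm)
    then have "g n - sgn (g n) = (norm (g n) - 1) *\<^sub>R sgn (g n)"
      by (simp add: scaleR_diff_left)
    then have "norm (g n - sgn (g n)) = \<bar>norm (g n) - 1\<bar> * norm (sgn (g n))"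
      by (metis norm_scaleR)
    with False show ?thesis
      by (simp add: norm_sgn)
  qed simp
  have abs0: "((\<lambda>n. \<bar>norm (g n) - 1\<bar>) \<longlongrightarrow> 0) F"
    using g by (simp add: LIM_zero tendsto_rabs_zero)
  have sgn_lim: "((\<lambda>n. norm (g n - sgn (g n))) \<longlongrightarrow> 0) F"
    by (rule tendsto_sandwich[OF _ _ tendsto_const abs0]) (simp_all add: diff)
  show ?thesis
  proof (rule tendstoI)
    fix e :: real
    assume e: "e > 0"
    obtain d where d: "d > 0"
        "\<And>y. norm y = 1 \<Longrightarrow> norm (x + y) > 2 - d \<Longrightarrow> norm (x - y) < e / 2"
      using L e unfolding LUR_point_iff_uniform by (meson half_gt_zero)
    have "\<forall>\<^sub>F n in F. norm (g n) > 0"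
      by (rule order_tendstoD(1)[OF g]) simp
    moreover have "\<forall>\<^sub>F n in F. norm (x + g n) > 2 - d / 2"
      by (rule order_tendstoD(1)[OF xg]) (use d in simp)
    \<comment> \<open>The share \<open>d / 2\<close> pays for replacing \<open>g n\<close> by
      \<open>sgn (g n)\<close> in \<open>norm (x + g n)\<close>, the share \<open>e / 2\<close> for
      the return to \<open>g n\<close> in \<open>norm (x - g n)\<close>.\<close>
    moreover have "\<forall>\<^sub>F n in F. norm (g n - sgn (g n)) < min (d / 2) (e / 2)"
      by (rule order_tendstoD(2)[OF sgn_lim]) (use d e in simp)
    ultimately show "\<forall>\<^sub>F n in F. dist (norm (x - g n)) 0 < e"
    proof eventually_elim
      case (elim n)
      have "norm (x + g n) \<le> norm (x + sgn (g n)) + norm (g n - sgn (g n))"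
        using norm_triangle_ineq[of "x + sgn (g n)" "g n - sgn (g n)"] by simp
      moreover have "norm (sgn (g n)) = 1"
        using elim by (simp add: norm_sgn)
      ultimately have "norm (x - sgn (g n)) < e / 2"
        using d(2) elim by simp
      moreover have "norm (x - g n) \<le> norm (x - sgn (g n)) + norm (g n - sgn (g n))"
        using norm_triangle_ineq4[of "x - sgn (g n)" "g n - sgn (g n)"] by simp
      ultimately show ?case
        using elim by simp
    qed
  qed
qed

text \<open>Finitely many singletons can be avoided at once, so \<open>U\<close> contains every tail
  and ordinary limits persist along \<open>U\<close>.\<close>

lemma free_ultrafilter_le_sequentially:
  assumes "free_ultrafilter U"
  shows "U \<le> sequentially"
proof -
  have ne: "\<forall>\<^sub>F n in U. n \<noteq> m" for m
    using assms unfolding free_ultrafilter_def by blast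
  have "\<forall>\<^sub>F n in U. k \<le> n" for k
  proof -
    have "\<forall>\<^sub>F n in U. \<forall>m\<in>{..<k}. n \<noteq> m"
      using ne by (simp add: eventually_ball_finite)
    then show ?thesis
      by (rule eventually_mono) (auto simp flip: not_less)
  qed
  then show ?thesis
    unfolding le_filter_def eventually_sequentially by (meson eventually_mono)
qed

text \<open>The points with parameters \<open>t\<close> and \<open>1 - t\<close> add up to
  \<open>x + y\<close>, and the mirrored one has norm at most 1.\<close>

lemma norm_segment_ge:
  fixes x y :: "'a::real_normed_vector"
  assumes "norm x = 1" "norm y = 1" "0 \<le> t" "t \<le> 1"
  shows "norm (x + y) - 1 \<le> norm ((1 - t) *\<^sub>R x + t *\<^sub>R y)"
proof -
  have "x + y = ((1 - t) *\<^sub>R x + t *\<^sub>R y) + (t *\<^sub>R x + (1 - t) *\<^sub>R y)"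
    by (simp add: algebra_simps)
  then have "norm (x + y) \<le> norm ((1 - t) *\<^sub>R x + t *\<^sub>R y) + norm (t *\<^sub>R x + (1 - t) *\<^sub>R y)"
    using norm_triangle_ineq by metis
  moreover have "norm (t *\<^sub>R x + (1 - t) *\<^sub>R y) \<le> 1"
    using norm_triangle_ineq[of "t *\<^sub>R x" "(1 - t) *\<^sub>R y"] assms by simp
  ultimately show ?thesis
    by simp
qed

lemma quotient_segment_coset:
  assumes "subspace N"
  shows "quotient_segment N (coset N f) (coset N g) =
    {coset N ((1 - t) *\<^sub>R f + t *\<^sub>R g) | t. 0 \<le> t \<and> t \<le> 1}"
  by (simp add: quotient_segment_def coset_scaleR_coset coset_add_coset assms)

lemma coset_mem_quotient_sphere_iff:
  fixes f :: "nat \<Rightarrow>\<^sub>C 'a::real_normed_vector"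
  assumes "free_ultrafilter U"
  shows "coset (null_seqs U) f \<in> quotient_sphere (null_seqs U) \<longleftrightarrow>
    ((\<lambda>n. norm (apply_bcontfun f n)) \<longlongrightarrow> 1) U"
proof -
  have "U \<noteq> bot"
    using assms by (simp add: free_ultrafilter_def)
  then show ?thesis
    using quotient_norm_coset_tendsto[OF assms, of f] tendsto_unique
    unfolding quotient_sphere_def quotient_space_def by fastforce
qed

text \<open>The midpoint of the embedded \<open>x\<close> and any point of the segment is again on
  the segment, so their sum has norm 2 and rotundity identifies them.\<close>

lemma LUR_point_segment_collapses:
  fixes a b :: "nat \<Rightarrow>\<^sub>C 'a::real_normed_vector"
  assumes U: "free_ultrafilter U" and L: "LUR_point x"
    and sub: "quotient_segment (null_seqs U) (coset (null_seqs U) a) (coset (null_seqs U) b)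
      \<subseteq> quotient_sphere (null_seqs U)"
    and t: "0 \<le> t" "t \<le> 1"
    and x: "ultrapower_embed U x = coset (null_seqs U) ((1 - t) *\<^sub>R a + t *\<^sub>R b)"
    and r: "0 \<le> r" "r \<le> 1"
  shows "coset (null_seqs U) ((1 - r) *\<^sub>R a + r *\<^sub>R b) = ultrapower_embed U x"
proof -
  let ?p = "\<lambda>t. (1 - t) *\<^sub>R a + t *\<^sub>R b"
  let ?c = "const_bcontfun x :: nat \<Rightarrow>\<^sub>C 'a"
  have lim: "((\<lambda>n. norm (apply_bcontfun (?p s) n)) \<longlongrightarrow> 1) U" if "0 \<le> s" "s \<le> 1" for s
    unfolding coset_mem_quotient_sphere_iff[OF U, symmetric]
    using sub that by (auto simp: quotient_segment_coset[OF subspace_null_seqs])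
  \<comment> \<open>\<open>?p\<close> is affine, so averaging the parameters gives the midpoint of
    \<open>?p t\<close> and \<open>?p r\<close>.\<close>
  define m where "m = ?p ((t + r) / 2)"
  have "?c - ?p t \<in> null_seqs U"
    using x by (simp add: ultrapower_embed_def coset_eq_iff[OF subspace_null_seqs])
  moreover have "?c + ?p r - 2 *\<^sub>R m = ?c - ?p t"
  proof -
    have "2 *\<^sub>R m = ?p t + ?p r"
    proof -
      have "2 * (1 - (t + r) / 2) = (1 - t) + (1 - r)" "2 * ((t + r) / 2) = t + r"
        by argo+
      then show ?thesis
        unfolding m_def scaleR_add_right scaleR_scaleR by (simp only: scaleR_add_left ac_simps)
    qed
    then show ?thesis by simp
  qed
  ultimately have eq: "coset (null_seqs U) (?c + ?p r) = coset (null_seqs U) (2 *\<^sub>R m)"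
    by (simp only: coset_eq_iff[OF subspace_null_seqs])
  have "((\<lambda>n. norm (apply_bcontfun m n)) \<longlongrightarrow> 1) U"
    unfolding m_def by (rule lim) (use t r in auto)
  then have "((\<lambda>n. norm (apply_bcontfun (2 *\<^sub>R m) n)) \<longlongrightarrow> 2) U"
    using tendsto_mult_left[of _ 1 U 2] by fastforce
  \<comment> \<open>The coset norm carries the limit 2 from \<open>2 *\<^sub>R m\<close> to the
    other representative \<open>?c + ?p r\<close>.\<close>
  then have "quotient_norm (coset (null_seqs U) (2 *\<^sub>R m)) = 2"
    using quotient_norm_coset_tendsto[OF U, of "2 *\<^sub>R m"] U tendsto_unique
    unfolding free_ultrafilter_def by blast
  then have "((\<lambda>n. norm (apply_bcontfun (?c + ?p r) n)) \<longlongrightarrow> 2) U"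
    using quotient_norm_coset_tendsto[OF U, of "?c + ?p r"] by (simp only: eq)
  then have "((\<lambda>n. norm (x + apply_bcontfun (?p r) n)) \<longlongrightarrow> 2) U"
    by (simp add: const_bcontfun.rep_eq)
  from LUR_point_tendsto[OF L lim[OF r] this]
  have "?c - ?p r \<in> null_seqs U"
    by (simp add: null_seqs_def const_bcontfun.rep_eq)
  then have "ultrapower_embed U x = coset (null_seqs U) (?p r)"
    by (simp add: ultrapower_embed_def coset_eq_iff[OF subspace_null_seqs])
  then show ?thesis ..
qed

theorem theorem2p2:
  fixes U :: "nat filter" and x :: "'a::banach"
  assumes "free_ultrafilter U" and "x \<in> sphere 0 1"
  shows "LUR_point x \<longleftrightarrow>
    \<not> (\<exists>A \<in> ultrapower U. \<exists>B \<in> ultrapower U. A \<noteq> B \<and>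
         ultrapower_embed U x \<in> quotient_segment (null_seqs U) A B \<and>
         quotient_segment (null_seqs U) A B \<subseteq> quotient_sphere (null_seqs U))"
    (is "_ \<longleftrightarrow> \<not> ?S")
proof
  assume L: "LUR_point x"
  show "\<not> ?S"
  proof
    assume ?S
    then obtain a b where ne: "coset (null_seqs U) a \<noteq> coset (null_seqs U) b"
      and mem: "ultrapower_embed U x \<in>
        quotient_segment (null_seqs U) (coset (null_seqs U) a) (coset (null_seqs U) b)"
      and sub: "quotient_segment (null_seqs U) (coset (null_seqs U) a) (coset (null_seqs U) b)
        \<subseteq> quotient_sphere (null_seqs U)"
      unfolding quotient_space_def by blast
    from mem obtain t where t: "0 \<le> t" "t \<le> 1"
        "ultrapower_embed U x = coset (null_seqs U) ((1 - t) *\<^sub>R a + t *\<^sub>R b)"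
      by (auto simp: quotient_segment_coset[OF subspace_null_seqs])
    \<comment> \<open>The parameters 0 and 1 send both endpoints to the embedded point, against
      \<open>A \<noteq> B\<close>.\<close>
    note collapse = LUR_point_segment_collapses[OF assms(1) L sub t]
    from collapse[of 0] collapse[of 1] ne show False
      by simp
  qed
next
  assume S: "\<not> ?S"
  have x: "norm x = 1"
    using assms(2) by simp
  show "LUR_point x"
  proof (rule ccontr)
    assume "\<not> LUR_point x"
    then have "\<not> (\<forall>e>0. \<exists>d>0. \<forall>y. norm y = 1 \<longrightarrow> norm (x + y) > 2 - d \<longrightarrow> norm (x - y) < e)"
      using x unfolding LUR_point_iff_uniform by blast
    from not_uniformly_rotund_at_sequence[OF x this] obtain e y
      where e: "e > 0" and y: "\<And>n::nat. norm (y n) = 1"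
        "(\<lambda>n. norm (x + y n)) \<longlonglongrightarrow> 2" "\<And>n. \<not> norm (x - y n) < e"
      by blast
    have "y \<in> bcontfun"
      by (rule bcontfun_normI[of _ 1]) (simp_all add: y(1))
    then have app: "apply_bcontfun (Bcontfun y) = y"
      by (rule Bcontfun_inverse)
    let ?c = "const_bcontfun x :: nat \<Rightarrow>\<^sub>C 'a"
    let ?N = "null_seqs U :: (nat \<Rightarrow>\<^sub>C 'a) set"
    have Ubot: "U \<noteq> bot"
      using assms(1) by (simp add: free_ultrafilter_def)
    \<comment> \<open>A null difference would put the distance below \<open>e\<close> at some index,
      as \<open>U\<close> is proper.\<close>
    have "?c - Bcontfun y \<notin> ?N"
    proof
      assume "?c - Bcontfun y \<in> ?N"
      then have "((\<lambda>n. norm (x - y n)) \<longlongrightarrow> 0) U"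
        by (simp add: null_seqs_def const_bcontfun.rep_eq app)
      from order_tendstoD(2)[OF this e] y(3) Ubot show False
        by simp
    qed
    then have "coset ?N ?c \<noteq> coset ?N (Bcontfun y)"
      by (simp add: coset_eq_iff[OF subspace_null_seqs])
    moreover have "ultrapower_embed U x \<in> quotient_segment ?N (coset ?N ?c) (coset ?N (Bcontfun y))"
      unfolding quotient_segment_coset[OF subspace_null_seqs] ultrapower_embed_def
      by (intro CollectI exI[of _ 0]) simp
    moreover have "coset ?N ((1 - t) *\<^sub>R ?c + t *\<^sub>R Bcontfun y) \<in> quotient_sphere ?N"
      if t: "0 \<le> t" "t \<le> 1" for t
    proof -
      \<comment> \<open>\<open>norm_segment_ge\<close> bounds the norms below by a sequence tending
        to 1, convexity of the ball bounds them above by 1.\<close>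
      have "(\<lambda>n. norm ((1 - t) *\<^sub>R x + t *\<^sub>R y n)) \<longlonglongrightarrow> 1"
      proof (rule tendsto_sandwich)
        show "(\<lambda>n. norm (x + y n) - 1) \<longlonglongrightarrow> 1"
          using tendsto_diff[OF y(2) tendsto_const, of 1] by simp
        show "\<forall>\<^sub>F n in sequentially. norm (x + y n) - 1 \<le> norm ((1 - t) *\<^sub>R x + t *\<^sub>R y n)"
          using norm_segment_ge[OF x y(1) t] by (intro always_eventually allI)
        have "norm ((1 - t) *\<^sub>R x + t *\<^sub>R y n) \<le> 1" for n
          using norm_triangle_ineq[of "(1 - t) *\<^sub>R x" "t *\<^sub>R y n"] x y(1)[of n] t by simp
        then show "\<forall>\<^sub>F n in sequentially. norm ((1 - t) *\<^sub>R x + t *\<^sub>R y n) \<le> 1"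
          by (intro always_eventually allI)
      qed auto
      from tendsto_mono[OF free_ultrafilter_le_sequentially[OF assms(1)] this]
      show ?thesis
        by (simp add: coset_mem_quotient_sphere_iff[OF assms(1)] const_bcontfun.rep_eq app)
    qed
    then have "quotient_segment ?N (coset ?N ?c) (coset ?N (Bcontfun y)) \<subseteq> quotient_sphere ?N"
      by (auto simp: quotient_segment_coset[OF subspace_null_seqs])
    ultimately show False
      using S unfolding quotient_space_def by blast
  qed
qed

end
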